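(* Let $X$ be a set and let $R: X\times X\to X\times X$ be a map. For $n\ge 2$ and $i=1,\dots,n$ define the monodromy maps $T_i^{(n)}:X^n\to X^n$ by $$T_i^{(n)} = R_{i\,i+n-1}\,R_{i\,i+n-2}\cdots R_{i\,i+1},$$ where the product is composition of maps and the indices are taken modulo $n$ with representatives in $\{1,\dots,n\}$. (1) If $R$ is a reversible Yang-Baxter map, then for every $n\ge 2$ the monodromy maps commute with each other, $$T_i^{(n)}T_j^{(n)}=T_j^{(n)}T_i^{(n)}\qquad (i,j=1,\dots,n),$$ and satisfy $$T_1^{(n)}T_2^{(n)}\cdots T_n^{(n)}=\mathrm{Id}.$$ (2) Conversely, suppose that for every $n\ge 2$ the maps $T_1^{(n)},\dots,T_n^{(n)}$ commute pairwise and satisfy $T_1^{(n)}T_2^{(n)}\cdots T_n^{(n)}=\mathrm{Id}$. Then $R$ is a reversible Yang-Baxter map.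
   Context: Write $R(x,y)=(f(x,y),g(x,y))$ for $x,y\in X$. For $n\ge2$ and distinct $i,j\in\{1,\dots,n\}$, the map $R_{ij}:X^n\to X^n$ acts as $R$ on the $i$-th and $j$-th factors (in this order) and identically on the others: it sends $(x_1,\dots,x_n)$ to the tuple whose $i$-th entry is $f(x_i,x_j)$, whose $j$-th entry is $g(x_i,x_j)$, and whose $k$-th entry is $x_k$ for $k\ne i,j$ (this applies both for $i<j$ and for $i>j$). In particular, for $n=2$, $R_{12}=R$ and $R_{21}(x,y)=(g(y,x),f(y,x))$, i.e. $R_{21}=PRP$ with $P(x,y)=(y,x)$. Products of maps denote composition, the rightmost map being applied first. Example: $T_1^{(n)}=R_{1n}R_{1\,n-1}\cdots R_{12}$, and for $n=3$: $T_1^{(3)}=R_{13}R_{12}$, $T_2^{(3)}=R_{21}R_{23}$, $T_3^{(3)}=R_{32}R_{31}$. $R$ is called a Yang-Baxter map if $R_{12}R_{13}R_{23}=R_{23}R_{13}R_{12}$ as maps $X^3\to X^3$. It is called a reversible Yang-Baxter map if additionally $R_{21}R=\mathrm{Id}$ as maps $X^2\to X^2$. *)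

theory Defs
  imports Main "HOL-Library.FuncSet"
begin

text \<open>
  The power \<open>X\<^sup>n\<close> is the set of functions with domain \<open>{1..n}\<close> and values in \<open>X\<close>
  (\<open>undefined\<close> outside \<open>{1..n}\<close>), so that \<open>n\<close> can be quantified over and \<open>X\<close> may be empty.
  Maps \<open>X\<^sup>n \<rightarrow> X\<^sup>n\<close> are represented by functions on \<open>nat \<Rightarrow> 'a\<close> and are only ever
  compared on \<open>X\<^sup>n\<close>.
\<close>

definition power_set :: "'a set \<Rightarrow> nat \<Rightarrow> (nat \<Rightarrow> 'a) set" where
  "power_set X n = {1..n} \<rightarrow>\<^sub>E X"

text \<open>Meant for \<open>i \<noteq> j\<close>; the values of \<open>R\<close> are read off at the original tuple \<open>x\<close>.\<close>

definition act :: "('a \<times> 'a \<Rightarrow> 'a \<times> 'a) \<Rightarrow> nat \<Rightarrow> nat \<Rightarrow> (nat \<Rightarrow> 'a) \<Rightarrow> (nat \<Rightarrow> 'a)" where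
  "act R i j x = x(i := fst (R (x i, x j)), j := snd (R (x i, x j)))"

text \<open>\<open>prod_maps [F\<^sub>1, \<dots>, F\<^sub>m] = F\<^sub>1 \<circ> \<dots> \<circ> F\<^sub>m\<close>; the last map in the list is applied first.\<close>

definition prod_maps :: "('b \<Rightarrow> 'b) list \<Rightarrow> ('b \<Rightarrow> 'b)" where
  "prod_maps Fs = foldr (\<circ>) Fs id"

text \<open>The representative in \<open>{1..n}\<close> of \<open>k\<close> modulo \<open>n\<close>, for \<open>k \<ge> 1\<close>.\<close>

definition cyc :: "nat \<Rightarrow> nat \<Rightarrow> nat" where
  "cyc n k = (k - 1) mod n + 1"

definition monodromy :: "('a \<times> 'a \<Rightarrow> 'a \<times> 'a) \<Rightarrow> nat \<Rightarrow> nat \<Rightarrow> (nat \<Rightarrow> 'a) \<Rightarrow> (nat \<Rightarrow> 'a)" where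
  "monodromy R n i = prod_maps (map (\<lambda>k. act R i (cyc n (i + k))) (rev [1..<n]))"

definition yang_baxter_map :: "'a set \<Rightarrow> ('a \<times> 'a \<Rightarrow> 'a \<times> 'a) \<Rightarrow> bool" where
  "yang_baxter_map X R \<longleftrightarrow>
     (\<forall>x \<in> power_set X 3.
        (act R 1 2 \<circ> act R 1 3 \<circ> act R 2 3) x = (act R 2 3 \<circ> act R 1 3 \<circ> act R 1 2) x)"

text \<open>Under \<open>X\<^sup>2 \<cong> X \<times> X\<close> the map \<open>R\<close> is \<open>act R 1 2\<close>.\<close>

definition reversible_yang_baxter_map :: "'a set \<Rightarrow> ('a \<times> 'a \<Rightarrow> 'a \<times> 'a) \<Rightarrow> bool" where
  "reversible_yang_baxter_map X R \<longleftrightarrow>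
     yang_baxter_map X R \<and>
     (\<forall>x \<in> power_set X 2. (act R 2 1 \<circ> act R 1 2) x = x)"

definition monodromies_commute :: "'a set \<Rightarrow> ('a \<times> 'a \<Rightarrow> 'a \<times> 'a) \<Rightarrow> nat \<Rightarrow> bool" where
  "monodromies_commute X R n \<longleftrightarrow>
     (\<forall>i \<in> {1..n}. \<forall>j \<in> {1..n}. \<forall>x \<in> power_set X n.
        (monodromy R n i \<circ> monodromy R n j) x = (monodromy R n j \<circ> monodromy R n i) x)"

definition monodromy_product_is_id :: "'a set \<Rightarrow> ('a \<times> 'a \<Rightarrow> 'a \<times> 'a) \<Rightarrow> nat \<Rightarrow> bool" where
  "monodromy_product_is_id X R n \<longleftrightarrow>
     (\<forall>x \<in> power_set X n. prod_maps (map (monodromy R n) [1..<n + 1]) x = x)"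

end

(*
  The operators R_ij with disjoint index pairs commute. In T_1 ... T_n all factors cancel in pairs
  R_ij R_ji after such commutations; no Yang-Baxter equation is involved. For i < j write, in cyclic
  order, B for the indices strictly between i and j and C for those strictly between j and i. Then
  T_i = R_iC R_ij R_iB and T_j = R_jB R_ji R_jC, and the Yang-Baxter equation for blocks,
  R_ij R_iB R_jB = R_jB R_iB R_ij, brings both T_i T_j and T_j T_i to R_jB R_iC R_jC R_iB.
  Conversely, n = 2 yields reversibility, and T_1 T_2 = T_2 T_1 for n = 3, where
  T_1 T_2 = R_13 R_12 R_21 R_23 = R_13 R_23, is the Yang-Baxter equation.
*)
theory Submission
  imports Defs
begin

section \<open>Words in the operators \<open>R\<^sub>i\<^sub>j\<close>\<close>

lemma prod_maps_Nil [simp]: "prod_maps [] = id"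
  and prod_maps_Cons [simp]: "prod_maps (F # Fs) = F \<circ> prod_maps Fs"
  by (simp_all add: prod_maps_def)

lemma prod_maps_append [simp]: "prod_maps (Fs @ Gs) = prod_maps Fs \<circ> prod_maps Gs"
  by (induction Fs) (simp_all add: comp_assoc)

text \<open>\<open>fold\<close> applies the head of the list first, so a product with descending
  indices is a \<open>fold\<close> over the ascending list; every word is handled in this form
  below.\<close>

lemma prod_maps_rev: "prod_maps (map f (rev ks)) = fold f ks"
  by (induction ks) simp_all

lemma act_commute:
  assumes "{i, j} \<inter> {k, l} = {}"
  shows "act R i j (act R k l x) = act R k l (act R i j x)"
  using assms by (auto simp: act_def fun_eq_iff)

lemma act_fold_commute:
  assumes "i \<noteq> k" "j \<noteq> k" "i \<notin> set w" "j \<notin> set w"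
  shows "act R i j (fold (act R k) w x) = fold (act R k) w (act R i j x)"
  using assms by (induction w arbitrary: x) (simp_all add: act_commute)

lemma fold_fold_commute:
  assumes "i \<noteq> k" "i \<notin> set w" "k \<notin> set v" "set v \<inter> set w = {}"
  shows "fold (act R i) v (fold (act R k) w x) = fold (act R k) w (fold (act R i) v x)"
  using assms by (induction v arbitrary: x) (simp_all add: act_fold_commute)

lemma upt_split:
  assumes "i \<le> j" "j < n"
  shows "[i..<n] = [i..<j] @ j # [Suc j..<n]"
  using assms upt_add_eq_append[of i j "n - j"] by (simp add: upt_conv_Cons)

text \<open>Walking cyclically from the successor of \<open>i\<close>, the indices run up to
  \<open>n\<close> and then wrap to 1. After this no arithmetic modulo \<open>n\<close> is
  left.\<close>

lemma map_cyc_upt: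
  assumes "i \<in> {1..n}"
  shows "map (\<lambda>k. cyc n (i + k)) [1..<n] = [Suc i..<Suc n] @ [1..<i]"
proof (rule nth_equalityI)
  show "length (map (\<lambda>k. cyc n (i + k)) [1..<n]) = length ([Suc i..<Suc n] @ [1..<i])"
    using assms by auto
next
  fix m assume "m < length (map (\<lambda>k. cyc n (i + k)) [1..<n])"
  then have m: "m < n - 1" by simp
  \<comment> \<open>Position \<open>m\<close> holds the shift \<open>k = m + 1\<close>, and this 1
    cancels the \<open>k - 1\<close> in \<open>cyc\<close>.\<close>
  have "(i + m) mod n + 1 = ([Suc i..<Suc n] @ [1..<i]) ! m"
  proof (cases "i + m < n")
    case True
    then have "m < n - i" by simp
    then show ?thesis using True by (simp add: nth_append del: upt_Suc)
  next
    case False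
    then have "i + m - n < n" "n \<le> i + m" "\<not> m < n - i"
      using assms m by auto
    then have "(i + m) mod n = i + m - n"
      by (simp add: le_mod_geq)
    then show ?thesis using \<open>\<not> m < n - i\<close> assms m
      by (simp add: nth_append add.commute del: upt_Suc)
  qed
  then show "map (\<lambda>k. cyc n (i + k)) [1..<n] ! m = ([Suc i..<Suc n] @ [1..<i]) ! m"
    using m by (simp add: cyc_def del: upt_Suc)
qed

lemma monodromy_eq_fold:
  assumes "i \<in> {1..n}"
  shows "monodromy R n i = fold (act R i) ([Suc i..<Suc n] @ [1..<i])"
proof -
  have "monodromy R n i = prod_maps (map (act R i) (rev (map (\<lambda>k. cyc n (i + k)) [1..<n])))"
    by (simp add: monodromy_def rev_map comp_def)
  then show ?thesis
    by (simp only: prod_maps_rev map_cyc_upt[OF assms])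
qed

section \<open>The product of the monodromy maps\<close>

text \<open>Each word acts first by R_ik. These factors can be collected on the right: R_ik passes
  R_lj for i < l < m and j > k, because the four indices are distinct.\<close>

lemma prod_maps_fold_split:
  assumes "m \<le> k" "k \<le> n"
  shows "prod_maps (map (\<lambda>i. fold (act R i) [k..<Suc n]) [1..<m])
       = prod_maps (map (\<lambda>i. fold (act R i) [Suc k..<Suc n]) [1..<m])
         \<circ> prod_maps (map (\<lambda>i. act R i k) [1..<m])"
  using assms(1)
proof (induction m)
  case (Suc m)
  have step: "fold (act R m) [k..<Suc n] = fold (act R m) [Suc k..<Suc n] \<circ> act R m k"
    using assms(2) by (simp add: upt_conv_Cons del: upt_Suc)
  have comm: "prod_maps (map (\<lambda>i. act R i k) [1..<m]) (fold (act R m) [Suc k..<Suc n] x)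
      = fold (act R m) [Suc k..<Suc n] (prod_maps (map (\<lambda>i. act R i k) [1..<m]) x)" for x
  proof -
    have "prod_maps (map (\<lambda>i. act R i k) is) (fold (act R m) [Suc k..<Suc n] x)
      = fold (act R m) [Suc k..<Suc n] (prod_maps (map (\<lambda>i. act R i k) is) x)"
      if "set is \<subseteq> {..<m}" for "is"
      using that
    proof (induction "is")
      case (Cons i "is")
      then have "i < m" "m < k" using Suc.prems by auto
      then show ?case using Cons by (simp add: act_fold_commute del: upt_Suc)
    qed simp
    then show ?thesis by (simp add: subset_eq)
  qed
  show ?case
  proof (cases "m = 0")
    case False
    then have "[1..<Suc m] = [1..<m] @ [m]" by simp
    then show ?thesis using Suc
      by (simp add: step comm fun_eq_iff del: upt_Suc One_nat_def)
  qed simp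
qed simp

text \<open>The word R_1k R_2k ... R_k2 R_k1 collapses from its middle outwards.\<close>

lemma prod_maps_act_fold_cancel:
  assumes inv: "\<And>i j x. i \<noteq> j \<Longrightarrow> act R i j (act R j i x) = x" and "m \<le> k"
  shows "prod_maps (map (\<lambda>i. act R i k) [1..<m]) (fold (act R k) [1..<m] x) = x"
  using assms(2) by (induction m) (auto simp: inv)

lemma prod_monodromy_eq_id:
  assumes inv: "\<And>i j x. i \<noteq> j \<Longrightarrow> act R i j (act R j i x) = x"
  shows "prod_maps (map (monodromy R n) [1..<n + 1]) = id"
proof -
  \<comment> \<open>In the product of the first k monodromy maps only the R_ij with i <= k < j
    survive. The next map begins on its left with the word that cancels all R_ij with j = k +
    1.\<close>
  have "prod_maps (map (monodromy R n) [1..<Suc k])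
      = prod_maps (map (\<lambda>i. fold (act R i) [Suc k..<Suc n]) [1..<Suc k])" if "k \<le> n" for k
    using that
  proof (induction k)
    case (Suc k)
    have T: "monodromy R n (Suc k)
        = fold (act R (Suc k)) [1..<Suc k] \<circ> fold (act R (Suc k)) [Suc (Suc k)..<Suc n]"
      using Suc.prems by (simp add: monodromy_eq_fold del: upt_Suc)
    have upt: "[1..<Suc (Suc k)] = [1..<Suc k] @ [Suc k]" by simp
    show ?case
      using Suc unfolding upt
      by (intro ext) (simp add: T prod_maps_fold_split[of "Suc k" "Suc k"]
          prod_maps_act_fold_cancel inv del: upt_Suc One_nat_def)
  qed simp
  from this[of n] have "prod_maps (map (monodromy R n) [1..<n + 1])
      = prod_maps (map (\<lambda>i. id) [1..<n + 1])"
    by (simp add: id_def del: upt_Suc)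
  also have "\<dots> = id"
  proof -
    have "prod_maps (map (\<lambda>i. id) is) = (id :: (nat \<Rightarrow> 'a) \<Rightarrow> _)" for "is" :: "nat list"
      by (induction "is") simp_all
    then show ?thesis .
  qed
  finally show ?thesis .
qed

section \<open>Commutation of the monodromy maps\<close>

text \<open>Induction on the block: R_ik, for the head \<open>k\<close>, commutes with the rest of
  the word of \<open>j\<close>, so one Yang-Baxter equation settles \<open>k\<close> and the rest is
  the induction hypothesis.\<close>

lemma yang_baxter_fold:
  assumes yb: "\<And>i j k x. distinct [i, j, k] \<Longrightarrow>
      act R i j (act R i k (act R j k x)) = act R j k (act R i k (act R i j x))"
    and "i \<noteq> j" "i \<notin> set w" "j \<notin> set w" "distinct w"
  shows "act R i j (fold (act R i) w (fold (act R j) w x))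
       = fold (act R j) w (fold (act R i) w (act R i j x))"
  using assms(2-)
proof (induction w arbitrary: x)
  case (Cons k w)
  then have "act R i j (act R i k (act R j k x)) = act R j k (act R i k (act R i j x))" for x
    by (intro yb) auto
  with Cons show ?case by (simp add: act_fold_commute)
qed simp

lemma monodromy_commute_less:
  assumes inv: "\<And>i j x. i \<noteq> j \<Longrightarrow> act R i j (act R j i x) = x"
    and yb: "\<And>i j k x. distinct [i, j, k] \<Longrightarrow>
      act R i j (act R i k (act R j k x)) = act R j k (act R i k (act R i j x))"
    and "1 \<le> i" "i < j" "j \<le> n"
  shows "monodromy R n i (monodromy R n j x) = monodromy R n j (monodromy R n i x)"
proof -
  define B where "B = [Suc i..<j]"
  define C where "C = [Suc j..<Suc n] @ [1..<i]"
  have ij: "i \<noteq> j" using assms by simp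
  have B: "i \<notin> set B" "j \<notin> set B" "distinct B"
    and C: "i \<notin> set C" "j \<notin> set C" "distinct C" and BC: "set B \<inter> set C = {}"
    using assms by (auto simp: B_def C_def)
  have "[Suc i..<Suc n] = B @ j # [Suc j..<Suc n]"
    unfolding B_def using assms by (intro upt_split) auto
  then have Ti: "monodromy R n i = fold (act R i) (B @ j # C)"
    using assms by (simp add: monodromy_eq_fold C_def del: upt_Suc)
  have "[1..<j] = [1..<i] @ i # B"
    unfolding B_def using assms by (intro upt_split) auto
  then have Tj: "monodromy R n j = fold (act R j) (C @ i # B)"
    using assms by (simp add: monodromy_eq_fold C_def del: upt_Suc)
  let ?iB = "fold (act R i) B" and ?iC = "fold (act R i) C"
  let ?jB = "fold (act R j) B" and ?jC = "fold (act R j) C"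
  have ybB: "act R i j (?iB (?jB x)) = ?jB (?iB (act R i j x))" for x
    using yb ij B by (rule yang_baxter_fold)
  \<comment> \<open>Here \<open>i\<close> and \<open>j\<close> swap roles, since the cyclic walk
    from \<open>j\<close> meets \<open>C\<close> before \<open>i\<close>.\<close>
  have ybC: "act R j i (?jC (?iC x)) = ?iC (?jC (act R j i x))" for x
    using yb ij[symmetric] C(2,1,3) by (rule yang_baxter_fold)
  have "monodromy R n i (monodromy R n j x) = ?iC (?jB (?iB (act R i j (act R j i (?jC x)))))"
    by (simp add: Ti Tj ybB)
  also have "\<dots> = ?jB (?iC (?jC (?iB x)))"
    using ij B C BC by (simp add: inv fold_fold_commute[of i j] Int_commute)
  \<comment> \<open>A trivial pair is inserted so that \<open>ybC\<close>, read backwards,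
    reassembles the other product.\<close>
  also have "\<dots> = ?jB (?iC (?jC (act R j i (act R i j (?iB x)))))"
    using ij by (simp add: inv)
  also have "\<dots> = monodromy R n j (monodromy R n i x)"
    by (simp add: Ti Tj ybC)
  finally show ?thesis .
qed

lemma monodromy_commute:
  assumes inv: "\<And>i j x. i \<noteq> j \<Longrightarrow> act R i j (act R j i x) = x"
    and yb: "\<And>i j k x. distinct [i, j, k] \<Longrightarrow>
      act R i j (act R i k (act R j k x)) = act R j k (act R i k (act R i j x))"
    and "i \<in> {1..n}" "j \<in> {1..n}"
  shows "monodromy R n i (monodromy R n j x) = monodromy R n j (monodromy R n i x)"
proof (cases i j rule: linorder_cases)
  case less
  then show ?thesis using monodromy_commute_less[OF inv yb] assms(3,4) by simp
next
  case greater
  then show ?thesis using monodromy_commute_less[OF inv yb, of j i] assms(3,4) by simp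
qed simp

section \<open>Extension from \<open>X\<close> to the whole type\<close>

text \<open>
  Extending by the identity on pairs not in \<open>X \<times> X\<close> preserves both the Yang-Baxter equation and
  reversibility, so that all relations become equations of total functions.
\<close>

definition extend_id :: "'a set \<Rightarrow> ('a \<times> 'a \<Rightarrow> 'a \<times> 'a) \<Rightarrow> 'a \<times> 'a \<Rightarrow> 'a \<times> 'a" where
  "extend_id X R p = (if p \<in> X \<times> X then R p else p)"

lemma act_in_power_set:
  assumes "R \<in> X \<times> X \<rightarrow> X \<times> X" "x \<in> power_set X n" "i \<in> {1..n}" "j \<in> {1..n}"
  shows "act R i j x \<in> power_set X n"
proof -
  have "R (x i, x j) \<in> X \<times> X"
    using assms by (auto simp: power_set_def PiE_iff Pi_iff)
  then show ?thesis
    using assms(2-) by (auto simp: power_set_def act_def PiE_iff extensional_def mem_Times_iff)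
qed

lemma act_extend_id:
  assumes "x \<in> power_set X n" "i \<in> {1..n}" "j \<in> {1..n}"
  shows "act (extend_id X R) i j x = act R i j x"
  using assms by (auto simp: power_set_def act_def extend_id_def PiE_iff)

lemma fold_act_extend_id:
  assumes "R \<in> X \<times> X \<rightarrow> X \<times> X" "x \<in> power_set X n" "i \<in> {1..n}" "set w \<subseteq> {1..n}"
  shows "fold (act (extend_id X R) i) w x = fold (act R i) w x
       \<and> fold (act R i) w x \<in> power_set X n"
  using assms(2-)
  by (induction w arbitrary: x) (simp_all add: act_extend_id act_in_power_set[OF assms(1)])

lemma
  assumes "R \<in> X \<times> X \<rightarrow> X \<times> X" "x \<in> power_set X n" "i \<in> {1..n}"
  shows monodromy_extend_id: "monodromy (extend_id X R) n i x = monodromy R n i x"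
    and monodromy_in_power_set: "monodromy R n i x \<in> power_set X n"
proof -
  have "set ([Suc i..<Suc n] @ [1..<i]) \<subseteq> {1..n}"
    using assms(3) by auto
  from fold_act_extend_id[OF assms this]
  show "monodromy (extend_id X R) n i x = monodromy R n i x" "monodromy R n i x \<in> power_set X n"
    by (simp_all only: monodromy_eq_fold[OF assms(3)])
qed

text \<open>The right factors act first, so replacing the leftmost one requires that their value
  lies in the power of \<open>X\<close>; hence the joint induction.\<close>

lemma prod_monodromy_extend_id:
  assumes "R \<in> X \<times> X \<rightarrow> X \<times> X" "x \<in> power_set X n" "set is \<subseteq> {1..n}"
  shows "prod_maps (map (monodromy (extend_id X R) n) is) x = prod_maps (map (monodromy R n) is) x
       \<and> prod_maps (map (monodromy R n) is) x \<in> power_set X n"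
  using assms(3)
  by (induction "is")
    (simp_all add: assms(2) monodromy_extend_id[OF assms(1)] monodromy_in_power_set[OF assms(1)])

lemma extend_id_reversible:
  assumes "R \<in> X \<times> X \<rightarrow> X \<times> X" "\<forall>x \<in> power_set X 2. (act R 2 1 \<circ> act R 1 2) x = x" "i \<noteq> j"
  shows "act (extend_id X R) i j (act (extend_id X R) j i x) = x"
proof (cases "x j \<in> X \<and> x i \<in> X")
  case True
  \<comment> \<open>The inner map evaluates \<open>R\<close> at \<open>(x j, x i)\<close>, so
    \<open>x j\<close> has to stand in position 1.\<close>
  define y where "y = (\<lambda>m\<in>{1..2::nat}. if m = 1 then x j else x i)"
  have y: "y \<in> power_set X 2" using True by (auto simp: y_def power_set_def)
  obtain c d where cd: "R (x j, x i) = (c, d)" by fastforce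
  then have X: "c \<in> X" "d \<in> X" using assms(1) True by (force simp: Pi_iff)+
  have "act R 2 1 (act R 1 2 y) = y" using assms(2) y by simp
  from fun_cong[OF this, of 1] fun_cong[OF this, of 2]
  have "R (d, c) = (x i, x j)"
    by (simp add: act_def y_def cd prod_eq_iff)
  then show ?thesis
    using True X cd assms(3) by (auto simp: act_def extend_id_def fun_eq_iff)
next
  case False
  then show ?thesis by (auto simp: act_def extend_id_def)
qed

lemma act_extend_id_eq:
  assumes "x i \<notin> X \<or> x j \<notin> X"
  shows "act (extend_id X R) i j x = x"
  using assms by (auto simp: act_def extend_id_def)

text \<open>An entry outside \<open>X\<close> thus stays outside, and every later factor touching it
  is trivial.\<close>

lemma act_extend_id_in_iff:
  assumes "R \<in> X \<times> X \<rightarrow> X \<times> X"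
  shows "act (extend_id X R) i j x m \<in> X \<longleftrightarrow> x m \<in> X"
  using assms by (auto simp: act_def extend_id_def Pi_iff mem_Times_iff)

text \<open>Both sides depend only on the three entries involved, so the equation passes from
  positions 1, 2, 3 to any distinct ones.\<close>

lemma act_yang_baxter_transfer:
  assumes "distinct [i, j, k]" "distinct [i', j', k']" "x i = y i'" "x j = y j'" "x k = y k'"
    and "act R i' j' (act R i' k' (act R j' k' y)) = act R j' k' (act R i' k' (act R i' j' y))"
  shows "act R i j (act R i k (act R j k x)) = act R j k (act R i k (act R i j x))"
proof -
  \<comment> \<open>The left side evaluates to \<open>(a', b', c')\<close> by the first three
    equations, the right side to \<open>(p', q', r')\<close> by the last three.\<close>
  obtain b c where 1: "R (x j, x k) = (b, c)" by fastforce
  obtain a c' where 2: "R (x i, c) = (a, c')" by fastforce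
  obtain a' b' where 3: "R (a, b) = (a', b')" by fastforce
  obtain p q where 4: "R (x i, x j) = (p, q)" by fastforce
  obtain p' r where 5: "R (p, x k) = (p', r)" by fastforce
  obtain q' r' where 6: "R (q, r) = (q', r')" by fastforce
  note eqs = 1 2 3 4 5 6
  have "y(i' := a', j' := b', k' := c') = y(i' := p', j' := q', k' := r')"
    using assms(6) assms(2) eqs unfolding assms(3-5) by (simp add: act_def fun_upd_twist)
  from fun_cong[OF this, of i'] fun_cong[OF this, of j'] fun_cong[OF this, of k']
  have "a' = p'" "b' = q'" "c' = r'"
    using assms(2) by simp_all
  then show ?thesis
    using assms(1) eqs by (simp add: act_def fun_upd_twist)
qed

lemma extend_id_yang_baxter:
  assumes "R \<in> X \<times> X \<rightarrow> X \<times> X" "yang_baxter_map X R" "distinct [i, j, k]"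
  defines "Q \<equiv> extend_id X R"
  shows "act Q i j (act Q i k (act Q j k x)) = act Q j k (act Q i k (act Q i j x))"
proof (cases "x i \<in> X \<and> x j \<in> X \<and> x k \<in> X")
  case True
  define y where "y = (\<lambda>m\<in>{1..3::nat}. if m = 1 then x i else if m = 2 then x j else x k)"
  have y: "y \<in> power_set X 3" using True by (auto simp: y_def power_set_def)
  have "act R 1 2 (act R 1 3 (act R 2 3 y)) = act R 2 3 (act R 1 3 (act R 1 2 y))"
    using assms(2) y by (simp add: yang_baxter_map_def)
  then have eq: "act Q 1 2 (act Q 1 3 (act Q 2 3 y)) = act Q 2 3 (act Q 1 3 (act Q 1 2 y))"
    using y by (simp add: Q_def act_extend_id[where n = 3] act_in_power_set[OF assms(1)]
        del: One_nat_def)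
  show ?thesis
    by (rule act_yang_baxter_transfer[OF assms(3) _ _ _ _ eq]) (simp_all add: y_def)
next
  case False
  \<comment> \<open>With an entry outside \<open>X\<close>, at most one factor, the one on the other
    two positions, is nontrivial, and it occurs on both sides.\<close>
  then show ?thesis
    by (auto simp: Q_def act_extend_id_eq act_extend_id_in_iff[OF assms(1)])
qed

section \<open>Necessity and sufficiency of the relations\<close>

lemma reversible_imp_monodromies:
  assumes R: "R \<in> X \<times> X \<rightarrow> X \<times> X" and "reversible_yang_baxter_map X R"
  shows "monodromies_commute X R n \<and> monodromy_product_is_id X R n"
proof -
  define Q where "Q = extend_id X R"
  have inv: "act Q i j (act Q j i x) = x" if "i \<noteq> j" for i j x
    using extend_id_reversible[OF R _ that] assms(2)
    by (simp add: Q_def reversible_yang_baxter_map_def)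
  have yb: "act Q i j (act Q i k (act Q j k x)) = act Q j k (act Q i k (act Q i j x))"
    if "distinct [i, j, k]" for i j k x
    using extend_id_yang_baxter[OF R _ that] assms(2)
    by (simp add: Q_def reversible_yang_baxter_map_def)
  have "monodromies_commute X R n"
    unfolding monodromies_commute_def
  proof (intro ballI)
    fix i j x assume ij: "i \<in> {1..n}" "j \<in> {1..n}" and x: "x \<in> power_set X n"
    show "(monodromy R n i \<circ> monodromy R n j) x = (monodromy R n j \<circ> monodromy R n i) x"
      using monodromy_commute[OF inv yb ij, of x]
      by (simp add: Q_def monodromy_extend_id[OF R _ ij(1)] monodromy_extend_id[OF R _ ij(2)]
          monodromy_in_power_set[OF R _ ij(1)] monodromy_in_power_set[OF R _ ij(2)] x)
  qed
  moreover have "prod_maps (map (monodromy R n) [1..<n + 1]) x = x" if "x \<in> power_set X n" for x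
  proof -
    have "set [1..<n + 1] \<subseteq> {1..n}" by auto
    from prod_monodromy_extend_id[OF R that this] show ?thesis
      using prod_monodromy_eq_id[OF inv, of n] by (simp add: Q_def del: upt_Suc)
  qed
  ultimately show ?thesis by (simp add: monodromy_product_is_id_def)
qed

text \<open>Carries the relation from pairs to longer tuples, where it cancels R_12 R_21 inside
  words on triples.\<close>

lemma act_reversible_at:
  assumes "\<forall>y \<in> power_set X 2. act R 1 2 (act R 2 1 y) = y" "x 1 \<in> X" "x 2 \<in> X"
  shows "act R 1 2 (act R 2 1 x) = x"
proof -
  have "restrict x {1..2} \<in> power_set X 2"
  proof -
    have "{1..2::nat} = {1, 2}" by auto
    then show ?thesis using assms(2,3) by (auto simp: power_set_def)
  qed
  then have eq: "act R 1 2 (act R 2 1 (restrict x {1..2})) = restrict x {1..2}"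
    using assms(1) by blast
  show ?thesis
    using fun_cong[OF eq, of 1] fun_cong[OF eq, of 2] by (auto simp: act_def fun_eq_iff)
qed

lemma monodromies_imp_reversible:
  assumes R: "R \<in> X \<times> X \<rightarrow> X \<times> X"
    and comm: "monodromies_commute X R 2" "monodromies_commute X R 3"
    and prod: "monodromy_product_is_id X R 2"
  shows "reversible_yang_baxter_map X R"
proof -
  have T2: "monodromy R 2 1 = act R 1 2" "monodromy R 2 2 = act R 2 1"
    by (simp_all add: monodromy_eq_fold numeral_2_eq_2)
  have T3: "monodromy R 3 1 = act R 1 3 \<circ> act R 1 2" "monodromy R 3 2 = act R 2 1 \<circ> act R 2 3"
    by (simp_all add: monodromy_eq_fold numeral_2_eq_2 numeral_3_eq_3)
  have upt2: "[1..<3] = [1, 2 :: nat]" by (simp add: numeral_2_eq_2 numeral_3_eq_3)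
  have inv: "\<forall>y \<in> power_set X 2. act R 1 2 (act R 2 1 y) = y"
    using prod T2 by (simp add: monodromy_product_is_id_def upt2 del: One_nat_def)
  \<comment> \<open>The product relation gives R_12 R_21 = Id; commutation for n = 2 turns it into
    the order required by the definition.\<close>
  have rev: "\<forall>y \<in> power_set X 2. act R 2 1 (act R 1 2 y) = y"
  proof
    fix y assume y: "y \<in> power_set X 2"
    have "(monodromy R 2 1 \<circ> monodromy R 2 2) y = (monodromy R 2 2 \<circ> monodromy R 2 1) y"
      using comm(1) y unfolding monodromies_commute_def by auto
    then show "act R 2 1 (act R 1 2 y) = y"
      using inv y by (simp add: T2 del: One_nat_def)
  qed
  have "act R 1 2 (act R 1 3 (act R 2 3 x)) = act R 2 3 (act R 1 3 (act R 1 2 x))"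
    if x: "x \<in> power_set X 3" for x
  proof -
    have closed: "act R i j y \<in> power_set X 3"
      if "y \<in> power_set X 3" "i \<in> {1..3}" "j \<in> {1..3}" for i j y
      using act_in_power_set[OF R that] .
    have inv3: "act R 1 2 (act R 2 1 y) = y" if "y \<in> power_set X 3" for y
      using that by (intro act_reversible_at[OF inv]) (auto simp: power_set_def PiE_iff)
    have "(monodromy R 3 1 \<circ> monodromy R 3 2) x = (monodromy R 3 2 \<circ> monodromy R 3 1) x"
      using comm(2) x unfolding monodromies_commute_def by auto
    then have "act R 1 3 (act R 2 3 x) = act R 2 1 (act R 2 3 (act R 1 3 (act R 1 2 x)))"
      by (simp add: T3 inv3 closed x del: One_nat_def)
    \<comment> \<open>Applying R_12 to both sides removes R_21 on the right.\<close>
    then show ?thesis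
      by (simp add: inv3 closed x del: One_nat_def)
  qed
  with rev show ?thesis
    by (simp add: reversible_yang_baxter_map_def yang_baxter_map_def)
qed

theorem theorem1:
  fixes X :: "'a set" and R :: "'a \<times> 'a \<Rightarrow> 'a \<times> 'a"
  assumes "R \<in> X \<times> X \<rightarrow> X \<times> X"
  shows "(reversible_yang_baxter_map X R \<longrightarrow>
            (\<forall>n\<ge>2. monodromies_commute X R n \<and> monodromy_product_is_id X R n))
       \<and> ((\<forall>n\<ge>2. monodromies_commute X R n \<and> monodromy_product_is_id X R n) \<longrightarrow>
            reversible_yang_baxter_map X R)"
proof (intro conjI impI)
  assume "reversible_yang_baxter_map X R"
  then show "\<forall>n\<ge>2. monodromies_commute X R n \<and> monodromy_product_is_id X R n"
    using reversible_imp_monodromies[OF assms] by blast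
next
  assume "\<forall>n\<ge>2. monodromies_commute X R n \<and> monodromy_product_is_id X R n"
  then show "reversible_yang_baxter_map X R"
    by (intro monodromies_imp_reversible[OF assms]) simp_all
qed

end
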